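(* Let $n\ge2$. Suppose $\Omega_1,\ldots,\Omega_n$ are subsets of a normed vector space $X$, $\bar x\in\bigcap_{i=1}^n\Omega_i$ and $\alpha>0$. The following conditions are equivalent: (i) the collection $\{\Omega_1,\ldots,\Omega_n\}$ is approximately $\alpha$-stationary at $\bar x$; (ii) for any $\varepsilon>0$, there exist vectors $a_i\in X$ $(i=1,\ldots,n)$ such that $$\alpha\, d\Big(\bar x,\bigcap_{i=1}^n(\Omega_i-a_i)\Big)>\max_{1\le i\le n}d(\bar x,\Omega_i-a_i)\quad\text{and}\quad\max_{1\le i\le n}\|a_i\|<\varepsilon;$$ (iii) for any $\varepsilon>0$, there exist a point $x\in B_\varepsilon(\bar x)$ and vectors $a_i\in X$ $(i=1,\ldots,n)$ such that $$\alpha\, d\Big(x,\bigcap_{i=1}^n(\Omega_i-a_i)\Big)>\max_{1\le i\le n}d(x,\Omega_i-a_i)\quad\text{and}\quad\max_{1\le i\le n}\|a_i\|<\varepsilon.$$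
   Context: $B_\delta(x)$ is the open ball with centre $x$ and radius $\delta$, $\mathbb B$ is the open unit ball of $X$, $d(x,A):=\inf_{a\in A}\|x-a\|$ with $d(x,\emptyset):=+\infty$. Definition. The collection $\{\Omega_1,\ldots,\Omega_n\}$ is approximately $\alpha$-stationary at $\bar x$ if for any $\varepsilon>0$ there exist a number $\rho\in(0,\varepsilon)$, points $\omega_i\in\Omega_i\cap B_\varepsilon(\bar x)$ and vectors $a_i\in X$ $(i=1,\ldots,n)$ satisfying $$\bigcap_{i=1}^n(\Omega_i-\omega_i-a_i)\cap(\rho\mathbb B)=\emptyset\quad\text{and}\quad\max_{1\le i\le n}\|a_i\|<\alpha\rho.$$ *)

theory Defs
  imports "HOL-Analysis.Analysis" "HOL-Library.Extended_Real"
begin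

text \<open>
  Point-to-set distance with the convention that the distance to the empty set is infinite.
  The library constant \<open>infdist\<close> is not used, because it returns \<open>0\<close> for the empty set;
  here the infimum of the empty family in \<open>ereal\<close> is \<open>\<infinity>\<close>.
\<close>

definition edist_set :: "'a::real_normed_vector \<Rightarrow> 'a set \<Rightarrow> ereal" where
  "edist_set x A = (INF a\<in>A. ereal (norm (x - a)))"

definition translate_minus :: "'a::real_normed_vector set \<Rightarrow> 'a \<Rightarrow> 'a set" where
  "translate_minus A v = (\<lambda>w. w - v) ` A"

text \<open>
  A collection of \<open>n\<close> sets is a function on \<open>nat\<close> of which only the values at \<open>1, \<dots>, n\<close>
  matter.
\<close>

definition approx_stationary ::
    "real \<Rightarrow> nat \<Rightarrow> (nat \<Rightarrow> 'a::real_normed_vector set) \<Rightarrow> 'a \<Rightarrow> bool" where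
  "approx_stationary \<alpha> n \<Omega> xbar \<longleftrightarrow>
    (\<forall>\<epsilon>>0. \<exists>\<rho> \<omega> a. 0 < \<rho> \<and> \<rho> < \<epsilon> \<and>
      (\<forall>i\<in>{1..n}. \<omega> i \<in> \<Omega> i \<inter> ball xbar \<epsilon>) \<and>
      (\<Inter>i\<in>{1..n}. translate_minus (translate_minus (\<Omega> i) (\<omega> i)) (a i))
        \<inter> (\<lambda>u. \<rho> *\<^sub>R u) ` ball 0 1 = {} \<and>
      Max ((\<lambda>i. norm (a i)) ` {1..n}) < \<alpha> * \<rho>)"

end

theory Submission
  imports Defs
begin

text \<open>
  Translations identify the two kinds of data: writing \<open>a'\<^sub>i = x + a\<^sub>i - \<omega>\<^sub>i\<close>, the sets
  \<open>\<Omega>\<^sub>i - \<omega>\<^sub>i - a'\<^sub>i\<close> are the sets \<open>\<Omega>\<^sub>i - a\<^sub>i\<close> seen from \<open>x\<close>. Stationarity bounds the distance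
  from \<open>x\<close> to the intersection below by \<open>\<rho>\<close> and the individual distances above by \<open>\<parallel>a'\<^sub>i\<parallel> < \<alpha>\<rho>\<close>.
  Conversely, given the distance inequality, any \<open>\<rho>\<close> with \<open>\<alpha>\<rho>\<close> strictly between its two sides works,
  with \<open>\<omega>\<^sub>i\<close> an almost nearest point of \<open>\<Omega>\<^sub>i\<close> to \<open>x + a\<^sub>i\<close>. Since \<open>xbar \<in> \<Omega>\<^sub>i\<close>, the smaller side tends
  to \<open>0\<close> with \<open>x - xbar\<close> and \<open>a\<^sub>i\<close>, which makes \<open>\<rho>\<close> small.
\<close>

lemma mem_translate_minus [simp]: "w \<in> translate_minus A v \<longleftrightarrow> w + v \<in> A"
  unfolding translate_minus_def by (auto simp: image_iff algebra_simps)

lemma edist_set_less_iff: "edist_set x A < c \<longleftrightarrow> (\<exists>a\<in>A. ereal (norm (x - a)) < c)"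
  unfolding edist_set_def by (rule INF_less_iff)

text \<open>A strict upper bound on an infimum is met by an actual point. This form names the point
  of the untranslated set, which is what serves as \<open>\<omega> i\<close> below.\<close>

lemma edist_set_translate_minus_less_iff:
  "edist_set x (translate_minus A v) < ereal c \<longleftrightarrow> (\<exists>w\<in>A. norm (x + v - w) < c)"
proof -
  have "(\<exists>y. y + v \<in> A \<and> norm (x - y) < c) \<longleftrightarrow> (\<exists>w\<in>A. norm (x - (w - v)) < c)"
    by (metis add_diff_cancel diff_add_cancel)
  then show ?thesis
    by (simp add: edist_set_less_iff Bex_def algebra_simps)
qed

text \<open>Substitute \<open>y = x + u\<close>: by \<open>eq\<close>, membership of
  \<open>u\<close> in the doubly translated sets is membership of \<open>y\<close> in the sets
  translated by \<open>a i\<close>, and \<open>norm u\<close> becomes \<open>norm (x - y)\<close>.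
  As the ball is open, emptiness is exactly a non-strict lower bound; an empty intersection fits
  too, its distance being infinite.\<close>

lemma Inter_translate_minus_ball_empty_iff:
  fixes a b \<omega> :: "'i \<Rightarrow> 'a::real_normed_vector"
  assumes "\<rho> > 0" and eq: "\<And>i. i \<in> I \<Longrightarrow> \<omega> i + b i = x + a i"
  shows "(\<Inter>i\<in>I. translate_minus (translate_minus (\<Omega> i) (\<omega> i)) (b i))
           \<inter> (\<lambda>u. \<rho> *\<^sub>R u) ` ball 0 1 = {}
         \<longleftrightarrow> ereal \<rho> \<le> edist_set x (\<Inter>i\<in>I. translate_minus (\<Omega> i) (a i))"
proof -
  have ball: "(\<lambda>u. \<rho> *\<^sub>R u) ` ball (0::'a) 1 = ball 0 \<rho>"
    using ball_scale[of \<rho> "0::'a" 1] \<open>\<rho> > 0\<close> by simp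
  have shift: "u + b i + \<omega> i = (x + u) + a i" if "i \<in> I" for u i
    using eq[OF that] by (simp add: algebra_simps)
  have "(\<exists>u. norm u < \<rho> \<and> (\<forall>i\<in>I. u + b i + \<omega> i \<in> \<Omega> i))
        \<longleftrightarrow> (\<exists>u. norm u < \<rho> \<and> (\<forall>i\<in>I. (x + u) + a i \<in> \<Omega> i))"
    by (simp only: shift cong: ball_cong)
  also have "\<dots> \<longleftrightarrow> (\<exists>y. norm (x - y) < \<rho> \<and> (\<forall>i\<in>I. y + a i \<in> \<Omega> i))"
  proof (intro iffI; elim exE)
    fix u assume "norm u < \<rho> \<and> (\<forall>i\<in>I. (x + u) + a i \<in> \<Omega> i)"
    then show "\<exists>y. norm (x - y) < \<rho> \<and> (\<forall>i\<in>I. y + a i \<in> \<Omega> i)"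
      by (intro exI[of _ "x + u"]) simp
  next
    fix y assume "norm (x - y) < \<rho> \<and> (\<forall>i\<in>I. y + a i \<in> \<Omega> i)"
    then show "\<exists>u. norm u < \<rho> \<and> (\<forall>i\<in>I. (x + u) + a i \<in> \<Omega> i)"
      by (intro exI[of _ "y - x"]) (simp add: norm_minus_commute)
  qed
  also have "\<dots> \<longleftrightarrow> edist_set x (\<Inter>i\<in>I. translate_minus (\<Omega> i) (a i)) < ereal \<rho>"
    by (auto simp: edist_set_less_iff)
  finally show ?thesis
    unfolding ball not_less[symmetric] by (auto simp: disjoint_iff)
qed

lemma approx_stationary_imp_edist_set_less:
  fixes \<Omega> :: "nat \<Rightarrow> 'a::real_normed_vector set"
  assumes "n \<ge> 1" and "\<alpha> > 0" and "\<epsilon> > 0"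
    and stat: "approx_stationary \<alpha> n \<Omega> xbar"
  shows "\<exists>a :: nat \<Rightarrow> 'a.
          ereal \<alpha> * edist_set xbar (\<Inter>i\<in>{1..n}. translate_minus (\<Omega> i) (a i))
            > Max ((\<lambda>i. edist_set xbar (translate_minus (\<Omega> i) (a i))) ` {1..n})
        \<and> Max ((\<lambda>i. norm (a i)) ` {1..n}) < \<epsilon>"
proof -
  have ne: "{1..n} \<noteq> {}" using \<open>n \<ge> 1\<close> by simp
  \<comment> \<open>The two parts of \<open>a i\<close> have norms below \<open>\<delta>\<close> and
    \<open>\<alpha> * \<delta>\<close>, so they are made to add up to
    \<open>\<epsilon>\<close>.\<close>
  define \<delta> where "\<delta> = \<epsilon> / (1 + \<alpha>)"
  have "\<delta> > 0" using \<open>\<alpha> > 0\<close> \<open>\<epsilon> > 0\<close> by (simp add: \<delta>_def)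
  have "(1 + \<alpha>) * \<delta> = \<epsilon>" using \<open>\<alpha> > 0\<close> by (simp add: \<delta>_def)
  then have \<delta>: "\<delta> + \<alpha> * \<delta> = \<epsilon>" by (simp add: distrib_right)
  obtain \<rho> \<omega> b where "0 < \<rho>" "\<rho> < \<delta>"
    and \<omega>_ball: "\<forall>i\<in>{1..n}. \<omega> i \<in> \<Omega> i \<inter> ball xbar \<delta>"
    and empty: "(\<Inter>i\<in>{1..n}. translate_minus (translate_minus (\<Omega> i) (\<omega> i)) (b i))
        \<inter> (\<lambda>u. \<rho> *\<^sub>R u) ` ball 0 1 = {}"
    and Max_b: "Max ((\<lambda>i. norm (b i)) ` {1..n}) < \<alpha> * \<rho>"
    using stat[unfolded approx_stationary_def, rule_format, OF \<open>\<delta> > 0\<close>] by blast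
  have \<omega>: "\<omega> i \<in> \<Omega> i" "dist xbar (\<omega> i) < \<delta>" if "i \<in> {1..n}" for i
    using \<omega>_ball that by auto
  have b: "norm (b i) < \<alpha> * \<rho>" if "i \<in> {1..n}" for i
    using Max_b that ne by (subst (asm) Max_less_iff) auto
  \<comment> \<open>Chosen so that \<open>xbar + a i - \<omega> i = b i\<close>, which is
    \<open>eq\<close> at \<open>x = xbar\<close>.\<close>
  define a where "a i = \<omega> i + b i - xbar" for i
  have "norm (a i) < \<epsilon>" if "i \<in> {1..n}" for i
  proof -
    have "norm (a i) \<le> dist xbar (\<omega> i) + norm (b i)"
      using norm_triangle_ineq[of "\<omega> i - xbar" "b i"]
      by (simp add: a_def dist_norm norm_minus_commute algebra_simps)
    also have "\<dots> < \<delta> + \<alpha> * \<rho>"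
      using \<omega>(2) b that by (intro add_strict_mono) auto
    also have "\<dots> \<le> \<epsilon>"
      using \<open>\<rho> < \<delta>\<close> \<open>\<alpha> > 0\<close> \<delta> mult_left_mono[of \<rho> \<delta> \<alpha>] by linarith
    finally show ?thesis .
  qed
  moreover have "edist_set xbar (translate_minus (\<Omega> i) (a i))
      < ereal \<alpha> * edist_set xbar (\<Inter>i\<in>{1..n}. translate_minus (\<Omega> i) (a i))"
    if "i \<in> {1..n}" for i
  proof -
    have "edist_set xbar (translate_minus (\<Omega> i) (a i)) < ereal (\<alpha> * \<rho>)"
      unfolding edist_set_translate_minus_less_iff
      using \<omega>(1)[OF that] b[OF that] by (intro bexI[of _ "\<omega> i"]) (auto simp: a_def)
    also have "\<dots> = ereal \<alpha> * ereal \<rho>" by simp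
    also have "\<dots> \<le> ereal \<alpha> * edist_set xbar (\<Inter>i\<in>{1..n}. translate_minus (\<Omega> i) (a i))"
    proof (rule ereal_mult_left_mono)
      show "ereal \<rho> \<le> edist_set xbar (\<Inter>i\<in>{1..n}. translate_minus (\<Omega> i) (a i))"
        using empty \<open>0 < \<rho>\<close>
        by (subst (asm) Inter_translate_minus_ball_empty_iff[where x = xbar and a = a])
          (auto simp: a_def)
    qed (use \<open>\<alpha> > 0\<close> in simp)
    finally show ?thesis .
  qed
  ultimately show ?thesis
    using ne by (intro exI[of _ a] conjI) (auto simp: Max_less_iff)
qed

text \<open>The hypothesis \<open>dist\<close> is (iii), of which (ii) is the case
  \<open>x = xbar\<close>, so this closes the cycle of implications.\<close>

lemma edist_set_less_imp_approx_stationary: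
  fixes \<Omega> :: "nat \<Rightarrow> 'a::real_normed_vector set"
  assumes "n \<ge> 1" and "\<alpha> > 0" and xbar: "\<And>i. i \<in> {1..n} \<Longrightarrow> xbar \<in> \<Omega> i"
    and dist: "\<And>\<epsilon>. \<epsilon> > 0 \<Longrightarrow> \<exists>x\<in>ball xbar \<epsilon>. \<exists>a :: nat \<Rightarrow> 'a.
          ereal \<alpha> * edist_set x (\<Inter>i\<in>{1..n}. translate_minus (\<Omega> i) (a i))
            > Max ((\<lambda>i. edist_set x (translate_minus (\<Omega> i) (a i))) ` {1..n})
        \<and> Max ((\<lambda>i. norm (a i)) ` {1..n}) < \<epsilon>"
  shows "approx_stationary \<alpha> n \<Omega> xbar"
  unfolding approx_stationary_def
proof (intro allI impI)
  fix \<epsilon> :: real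
  assume "\<epsilon> > 0"
  have ne: "{1..n} \<noteq> {}" using \<open>n \<ge> 1\<close> by simp
  \<comment> \<open>With \<open>c < 2 * \<delta>\<close> below, the first bound gives
    \<open>\<delta> + (c + \<delta>) \<le> \<epsilon>\<close> for the points
    \<open>\<omega> i\<close>, the second gives \<open>c / \<alpha> < \<epsilon>\<close> for
    \<open>\<rho>\<close>.\<close>
  define \<delta> where "\<delta> = min (\<epsilon> / 4) (\<alpha> * \<epsilon> / 2)"
  have "\<delta> > 0" using \<open>\<alpha> > 0\<close> \<open>\<epsilon> > 0\<close> by (simp add: \<delta>_def)
  obtain x a where x: "dist xbar x < \<delta>"
    and lt: "Max ((\<lambda>i. edist_set x (translate_minus (\<Omega> i) (a i))) ` {1..n})
      < ereal \<alpha> * edist_set x (\<Inter>i\<in>{1..n}. translate_minus (\<Omega> i) (a i))"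
      (is "?M < ereal \<alpha> * ?D")
    and "Max ((\<lambda>i. norm (a i)) ` {1..n}) < \<delta>"
    using dist[OF \<open>\<delta> > 0\<close>] by (auto simp del: Max_less_iff)
  then have a: "norm (a i) < \<delta>" if "i \<in> {1..n}" for i
    using that ne by (subst (asm) Max_less_iff) auto
  \<comment> \<open>The point \<open>xbar\<close> of each \<open>\<Omega> i\<close> is a competitor
    for the infimum.\<close>
  have "?M < ereal (2 * \<delta>)"
  proof (subst Max_less_iff)
    show "\<forall>d\<in>(\<lambda>i. edist_set x (translate_minus (\<Omega> i) (a i))) ` {1..n}. d < ereal (2 * \<delta>)"
    proof clarify
      fix i assume i: "i \<in> {1..n}"
      have "norm (x + a i - xbar) \<le> dist xbar x + norm (a i)"
        using norm_triangle_ineq[of "x - xbar" "a i"]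
        by (simp add: dist_norm norm_minus_commute algebra_simps)
      then show "edist_set x (translate_minus (\<Omega> i) (a i)) < ereal (2 * \<delta>)"
        unfolding edist_set_translate_minus_less_iff
        using x a[OF i] xbar[OF i] by (intro bexI[of _ xbar]) auto
    qed
  qed (use ne in auto)
  with lt have "?M < min (ereal \<alpha> * ?D) (ereal (2 * \<delta>))" by simp
  \<comment> \<open>Needed to make \<open>c\<close>, and hence \<open>\<rho>\<close>,
    positive.\<close>
  moreover have "0 \<le> ?M"
  proof -
    have "0 \<le> edist_set x (translate_minus (\<Omega> 1) (a 1))"
      unfolding edist_set_def by (rule INF_greatest) simp
    also have "\<dots> \<le> ?M"
      using \<open>n \<ge> 1\<close> by (intro Max_ge) auto
    finally show ?thesis .
  qed
  \<comment> \<open>Density of the reals gives a finite \<open>c\<close> even if \<open>?D\<close>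
    is infinite; the cap \<open>2 * \<delta>\<close> keeps it small.\<close>
  moreover obtain c where "?M < ereal c" "ereal c < min (ereal \<alpha> * ?D) (ereal (2 * \<delta>))"
    using calculation(1) ereal_dense2 by blast
  ultimately have c: "?M < ereal c" "ereal c < ereal \<alpha> * ?D" "c < 2 * \<delta>" "0 < c"
    by (simp_all del: Max_less_iff) (metis ereal_less(2) order_le_less_trans)
  define \<rho> where "\<rho> = c / \<alpha>"
  have \<rho>: "\<alpha> * \<rho> = c" "0 < \<rho>" using \<open>\<alpha> > 0\<close> c by (auto simp: \<rho>_def)
  have "c < \<alpha> * \<epsilon>" using c(3) by (simp add: \<delta>_def)
  then have "\<rho> < \<epsilon>" using \<open>\<alpha> > 0\<close> by (simp add: \<rho>_def field_simps)
  \<comment> \<open>The gap between \<open>?M\<close> and \<open>c\<close> leaves room for almost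
    nearest points; nearest ones may not exist.\<close>
  have "\<exists>w\<in>\<Omega> i. norm (x + a i - w) < c" if "i \<in> {1..n}" for i
    unfolding edist_set_translate_minus_less_iff[symmetric]
    using c(1) that ne by (subst (asm) Max_less_iff) auto
  then obtain \<omega> where \<omega>: "\<And>i. i \<in> {1..n} \<Longrightarrow> \<omega> i \<in> \<Omega> i"
      "\<And>i. i \<in> {1..n} \<Longrightarrow> norm (x + a i - \<omega> i) < c"
    by metis
  define b where "b i = x + a i - \<omega> i" for i
  have "dist xbar (\<omega> i) < \<epsilon>" if "i \<in> {1..n}" for i
  proof -
    have "xbar - \<omega> i = (xbar - x) + (b i - a i)"
      by (simp add: b_def)
    then have "dist xbar (\<omega> i) \<le> dist xbar x + (norm (b i) + norm (a i))"
      unfolding dist_norm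
      by (metis norm_triangle_ineq norm_triangle_ineq4 add_left_mono order_trans)
    also have "\<dots> < \<delta> + (c + \<delta>)"
      using x a[OF that] \<omega>(2)[OF that] by (simp add: b_def)
    also have "\<dots> \<le> \<epsilon>"
      using c(3) by (simp add: \<delta>_def min_def split: if_splits)
    finally show ?thesis .
  qed
  moreover have "(\<Inter>i\<in>{1..n}. translate_minus (translate_minus (\<Omega> i) (\<omega> i)) (b i))
        \<inter> (\<lambda>u. \<rho> *\<^sub>R u) ` ball 0 1 = {}"
  proof (subst Inter_translate_minus_ball_empty_iff[where x = x and a = a])
    \<comment> \<open>If \<open>?D\<close> were below \<open>\<rho>\<close>, then
      \<open>\<alpha>\<close> times \<open>?D\<close> would be at most
      \<open>\<alpha> * \<rho> = c\<close>, against the choice of \<open>c\<close>.\<close>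
    show "ereal \<rho> \<le> ?D"
    proof (rule ccontr)
      assume "\<not> ereal \<rho> \<le> ?D"
      then have "ereal \<alpha> * ?D \<le> ereal \<alpha> * ereal \<rho>"
        using \<open>\<alpha> > 0\<close> by (intro ereal_mult_left_mono) auto
      with c(2) \<rho>(1) show False by simp
    qed
  qed (use \<rho> in \<open>auto simp: b_def\<close>)
  moreover have "Max ((\<lambda>i. norm (b i)) ` {1..n}) < \<alpha> * \<rho>"
    using \<omega>(2) ne by (subst Max_less_iff) (auto simp: b_def \<rho>)
  ultimately show "\<exists>\<rho> \<omega> b. 0 < \<rho> \<and> \<rho> < \<epsilon> \<and>
      (\<forall>i\<in>{1..n}. \<omega> i \<in> \<Omega> i \<inter> ball xbar \<epsilon>) \<and>
      (\<Inter>i\<in>{1..n}. translate_minus (translate_minus (\<Omega> i) (\<omega> i)) (b i))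
        \<inter> (\<lambda>u. \<rho> *\<^sub>R u) ` ball 0 1 = {} \<and>
      Max ((\<lambda>i. norm (b i)) ` {1..n}) < \<alpha> * \<rho>"
    using \<open>0 < \<rho>\<close> \<open>\<rho> < \<epsilon>\<close> \<omega>(1)
    by (intro exI[of _ \<rho>] exI[of _ \<omega>] exI[of _ b]) simp
qed

theorem corollary5p4:
  fixes n :: nat
    and \<Omega> :: "nat \<Rightarrow> 'a::real_normed_vector set"
    and xbar :: 'a
    and \<alpha> :: real
  assumes "n \<ge> 2"
    and "xbar \<in> (\<Inter>i\<in>{1..n}. \<Omega> i)"
    and "\<alpha> > 0"
  defines "cond_i \<equiv> approx_stationary \<alpha> n \<Omega> xbar"
    and "cond_ii \<equiv> (\<forall>\<epsilon>>0. \<exists>a :: nat \<Rightarrow> 'a.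
          ereal \<alpha> * edist_set xbar (\<Inter>i\<in>{1..n}. translate_minus (\<Omega> i) (a i))
            > Max ((\<lambda>i. edist_set xbar (translate_minus (\<Omega> i) (a i))) ` {1..n})
        \<and> Max ((\<lambda>i. norm (a i)) ` {1..n}) < \<epsilon>)"
    and "cond_iii \<equiv> (\<forall>\<epsilon>>0. \<exists>x\<in>ball xbar \<epsilon>. \<exists>a :: nat \<Rightarrow> 'a.
          ereal \<alpha> * edist_set x (\<Inter>i\<in>{1..n}. translate_minus (\<Omega> i) (a i))
            > Max ((\<lambda>i. edist_set x (translate_minus (\<Omega> i) (a i))) ` {1..n})
        \<and> Max ((\<lambda>i. norm (a i)) ` {1..n}) < \<epsilon>)"
  shows "(cond_i \<longleftrightarrow> cond_ii) \<and> (cond_ii \<longleftrightarrow> cond_iii)"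
proof -
  have n: "n \<ge> 1" using \<open>n \<ge> 2\<close> by simp
  have "cond_ii" if "cond_i"
    unfolding cond_ii_def
    using approx_stationary_imp_edist_set_less[OF n \<open>\<alpha> > 0\<close>] that[unfolded cond_i_def]
    by blast
  moreover have "cond_iii" if "cond_ii"
    unfolding cond_iii_def
  proof (intro allI impI)
    fix \<epsilon> :: real
    assume "\<epsilon> > 0"
    \<comment> \<open>The centre itself serves as the point \<open>x\<close>.\<close>
    then have "xbar \<in> ball xbar \<epsilon>" by simp
    with that[unfolded cond_ii_def, rule_format, OF \<open>\<epsilon> > 0\<close>]
    show "\<exists>x\<in>ball xbar \<epsilon>. \<exists>a :: nat \<Rightarrow> 'a.
          ereal \<alpha> * edist_set x (\<Inter>i\<in>{1..n}. translate_minus (\<Omega> i) (a i))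
            > Max ((\<lambda>i. edist_set x (translate_minus (\<Omega> i) (a i))) ` {1..n})
        \<and> Max ((\<lambda>i. norm (a i)) ` {1..n}) < \<epsilon>"
      by (rule bexI)
  qed
  moreover have "cond_i" if "cond_iii"
    unfolding cond_i_def
  proof (rule edist_set_less_imp_approx_stationary[OF n \<open>\<alpha> > 0\<close>])
    show "xbar \<in> \<Omega> i" if "i \<in> {1..n}" for i
      using assms(2) that by blast
  qed (use that[unfolded cond_iii_def] in blast)
  ultimately show ?thesis by blast
qed

end
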